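(* Let $1 \leq p \leq \infty$. The persistence landscape gives a $1$-Lipschitz embedding $$\Lambda: \left(D(\mathbb{R}^2_<),\, W_p^{\triangle}\right) \to L^p(\mathbb{N} \times \mathbb{R}), \qquad \alpha \mapsto \Lambda_\alpha;$$ that is, $\Lambda_\alpha \in L^p(\mathbb{N}\times\mathbb{R})$ for every $\alpha \in D(\mathbb{R}^2_<)$, the map $\Lambda$ is injective, and $\|\Lambda_\alpha - \Lambda_{\alpha'}\|_p \leq W_p^{\triangle}(\alpha,\alpha')$ for all $\alpha,\alpha' \in D(\mathbb{R}^2_<)$.
   Context: $\mathbb{R}^2_< = \{(b,d)\in\mathbb{R}^2 : b<d\}$. $D(\mathbb{R}^2_<)$ is the set of finite formal sums (finite multisets) $\sum_{i=1}^n x_i$, $n\geq 0$, of points of $\mathbb{R}^2_<$ (finite persistence diagrams); the empty sum is $0$. Let $\Delta$ denote an additional basepoint, the diagonal $\{(b,b): b\in\mathbb{R}\}$ collapsed to a point. For $x=(b,d)\in\mathbb{R}^2_<$ the triangle function $\triangle_x:\mathbb{R}\to[0,\infty)$ is $\triangle_x(t) = \inf\{|t-a| : a\in\mathbb{R}\setminus(b,d)\}$, the distance to the complement of the open interval $(b,d)$; $\triangle_\Delta = 0$. Put $d_p(x,y)=\|\triangle_x-\triangle_y\|_p$, the $L^p$ norm for Lebesgue measure on $\mathbb{R}$. The $p$-Wasserstein distance is $$W_p^{\triangle}\Big(\sum_{i=1}^m x_i, \sum_{i=1}^n y_i\Big) = \min_{\sigma \in \Sigma_{m+n}} \left\| (d_p(x_i,y_{\sigma(i)}))_{i=1}^{m+n}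 \right\|_p,$$ where $x_{m+1}=\cdots=x_{m+n}=\Delta=y_{n+1}=\cdots=y_{n+m}$ and $\Sigma_{m+n}$ is the symmetric group on $\{1,\dots,m+n\}$. It is a metric on $D(\mathbb{R}^2_<)$. The persistence landscape of $\alpha=\sum_{j=1}^n x_j$ is $\Lambda_\alpha(k,t) = \mathrm{kmax}\,(\triangle_{x_j}(t))_{j=1}^n$ for $k\in\mathbb{N}=\{1,2,\dots\}$, $t\in\mathbb{R}$, where $\mathrm{kmax}\, a$ is the $k$th largest element (with multiplicity) of the finite sequence $a=(a_1,\dots,a_n)$ if $k\leq n$, and $0$ if $k>n$. $\mathbb{N}\times\mathbb{R}$ carries the product of counting measure and Lebesgue measure. *)

theory Defs
  imports
    "HOL-Probability.Essential_Supremum"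
    "HOL-Combinatorics.Permutations"
    "HOL-Library.Multiset"
begin

section \<open>\<open>L\<^sup>p\<close> norms\<close>

definition epowr :: "ennreal \<Rightarrow> real \<Rightarrow> ennreal" where
  "epowr x a = (if x = \<infinity> then \<infinity> else ennreal (enn2real x powr a))"

text \<open>
  The norm is formed in the extended nonnegative reals for a function that is already
  nonnegative; it is used with \<open>\<bar>f\<bar>\<close> on measure spaces and, over a counting measure on a
  finite set, as the \<open>p\<close>-norm of a finite vector.
\<close>

definition Lp_enorm :: "ennreal \<Rightarrow> 'a measure \<Rightarrow> ('a \<Rightarrow> ennreal) \<Rightarrow> ennreal" where
  "Lp_enorm p M g =
     (if p = \<infinity> then esssup M g
      else epowr (\<integral>\<^sup>+x. epowr (g x) (enn2real p) \<partial>M) (1 / enn2real p))"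

definition Lp_norm :: "ennreal \<Rightarrow> 'a measure \<Rightarrow> ('a \<Rightarrow> real) \<Rightarrow> ennreal" where
  "Lp_norm p M f = Lp_enorm p M (\<lambda>x. ennreal \<bar>f x\<bar>)"

text \<open>
  Elements of \<open>L\<^sup>p\<close> are classes of functions that agree almost everywhere:
  \<open>Lp_functions\<close> collects the representatives, \<open>ae_class\<close> is the quotient map.
\<close>

definition Lp_functions :: "ennreal \<Rightarrow> 'a measure \<Rightarrow> ('a \<Rightarrow> real) set" where
  "Lp_functions p M = {f \<in> borel_measurable M. Lp_norm p M f < \<infinity>}"

definition ae_class :: "'a measure \<Rightarrow> ('a \<Rightarrow> real) \<Rightarrow> ('a \<Rightarrow> real) set" where
  "ae_class M f = {g \<in> borel_measurable M. AE x in M. g x = f x}"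

section \<open>Persistence diagrams and their Wasserstein distance\<close>

definition diagrams :: "(real \<times> real) multiset set" where
  "diagrams = {\<alpha>. \<forall>(b, d) \<in># \<alpha>. b < d}"

text \<open>The basepoint \<open>\<Delta>\<close> is represented by \<open>None\<close>.\<close>

fun triangle :: "(real \<times> real) option \<Rightarrow> real \<Rightarrow> real" where
  "triangle None t = 0"
| "triangle (Some (b, d)) t = (INF a \<in> - {b<..<d}. \<bar>t - a\<bar>)"

definition triangle_dist ::
    "ennreal \<Rightarrow> (real \<times> real) option \<Rightarrow> (real \<times> real) option \<Rightarrow> ennreal" where
  "triangle_dist p x y = Lp_norm p lborel (\<lambda>t. triangle x t - triangle y t)"

definition matching_cost ::
    "ennreal \<Rightarrow> (real \<times> real) option list \<Rightarrow> (real \<times> real) option list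
      \<Rightarrow> (nat \<Rightarrow> nat) \<Rightarrow> ennreal" where
  "matching_cost p as bs \<sigma> =
     Lp_enorm p (count_space {..<length as}) (\<lambda>i. triangle_dist p (as ! i) (bs ! \<sigma> i))"

definition pad :: "nat \<Rightarrow> 'a list \<Rightarrow> 'a option list" where
  "pad n xs = map Some xs @ replicate n None"

definition wasserstein_list ::
    "ennreal \<Rightarrow> (real \<times> real) list \<Rightarrow> (real \<times> real) list \<Rightarrow> ennreal" where
  "wasserstein_list p xs ys =
     (MIN \<sigma> \<in> {\<sigma>. \<sigma> permutes {..<length xs + length ys}}.
        matching_cost p (pad (length ys) xs) (pad (length xs) ys) \<sigma>)"

text \<open>
  The enumerations of the two diagrams are arbitrary; \<open>wasserstein_mset\<close> below shows that
  the value does not depend on them.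
\<close>

definition wasserstein ::
    "ennreal \<Rightarrow> (real \<times> real) multiset \<Rightarrow> (real \<times> real) multiset \<Rightarrow> ennreal" where
  "wasserstein p \<alpha> \<beta> =
     wasserstein_list p (SOME xs. mset xs = \<alpha>) (SOME ys. mset ys = \<beta>)"

lemma Lp_enorm_count_space_reindex:
  assumes "bij_betw \<pi> A A"
  shows "Lp_enorm p (count_space A) (\<lambda>i. g (\<pi> i)) = Lp_enorm p (count_space A) g"
proof -
  have "(AE i in count_space A. g (\<pi> i) \<le> z) \<longleftrightarrow> (AE i in count_space A. g i \<le> z)" for z
    using assms by (force simp: AE_count_space bij_betw_def)
  then have "esssup (count_space A) (\<lambda>i. g (\<pi> i)) = esssup (count_space A) g"
    by (simp add: esssup_eq_AE)
  moreover have "(\<integral>\<^sup>+i. epowr (g (\<pi> i)) r \<partial>count_space A) = (\<integral>\<^sup>+i. epowr (g i) r \<partial>count_space A)"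
    for r by (rule nn_integral_bij_count_space[OF assms])
  ultimately show ?thesis
    by (simp add: Lp_enorm_def)
qed

lemma mset_eq_nth_permutation:
  assumes "mset xs = mset ys"
  obtains \<pi> where "\<pi> permutes {..<length xs}" "\<And>i. i < length xs \<Longrightarrow> ys ! i = xs ! \<pi> i"
proof -
  obtain \<pi> where "\<pi> permutes {..<length xs}" "permute_list \<pi> xs = ys"
    using mset_eq_permutation[of ys xs] assms by metis
  then show ?thesis
    using that permute_list_nth by blast
qed

lemma matching_cost_perm_image:
  assumes as: "mset as = mset as'" and bs: "mset bs = mset bs'"
    and len: "length as = N" "length bs = N"
  shows "matching_cost p as' bs' ` {\<sigma>. \<sigma> permutes {..<N}}
       \<subseteq> matching_cost p as bs ` {\<sigma>. \<sigma> permutes {..<N}}"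
proof safe
  fix \<sigma> :: "nat \<Rightarrow> nat" assume \<sigma>: "\<sigma> permutes {..<N}"
  obtain \<pi> where \<pi>: "\<pi> permutes {..<N}" "\<And>i. i < N \<Longrightarrow> as' ! i = as ! \<pi> i"
    using mset_eq_nth_permutation[OF as] len by metis
  obtain \<rho> where \<rho>: "\<rho> permutes {..<N}" "\<And>i. i < N \<Longrightarrow> bs' ! i = bs ! \<rho> i"
    using mset_eq_nth_permutation[OF bs] len by metis
  have len': "length as' = N"
    using as len by (metis size_mset)
  define \<tau> where "\<tau> = \<rho> \<circ> \<sigma> \<circ> inv \<pi>"
  have \<tau>: "\<tau> permutes {..<N}"
    unfolding \<tau>_def by (intro permutes_compose permutes_inv \<pi> \<rho> \<sigma>)
  have eq: "bs' ! \<sigma> i = bs ! \<tau> (\<pi> i)" if "i < N" for i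
    using that \<rho>(2)[of "\<sigma> i"] permutes_in_image[OF \<sigma>, of i] permutes_inverses[OF \<pi>(1)]
    by (simp add: \<tau>_def)
  have "matching_cost p as' bs' \<sigma> =
      Lp_enorm p (count_space {..<N}) (\<lambda>i. triangle_dist p (as ! \<pi> i) (bs ! \<tau> (\<pi> i)))"
    unfolding matching_cost_def Lp_enorm_def len'
    by (auto simp: \<pi>(2) eq esssup_eq_AE AE_count_space intro!: nn_integral_cong arg_cong2[where f = epowr])
  also have "\<dots> = matching_cost p as bs \<tau>"
    unfolding matching_cost_def len(1)
    by (rule Lp_enorm_count_space_reindex[OF permutes_imp_bij[OF \<pi>(1)],
          where g = "\<lambda>i. triangle_dist p (as ! i) (bs ! \<tau> i)"])
  finally show "matching_cost p as' bs' \<sigma> \<in> matching_cost p as bs ` {\<sigma>. \<sigma> permutes {..<N}}"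
    using \<tau> by blast
qed

lemma wasserstein_mset: "wasserstein p (mset xs) (mset ys) = wasserstein_list p xs ys"
proof -
  define xs' where "xs' = (SOME zs. mset zs = mset xs)"
  define ys' where "ys' = (SOME zs. mset zs = mset ys)"
  have eq: "mset xs' = mset xs" "mset ys' = mset ys"
    unfolding xs'_def ys'_def by (rule someI, rule refl)+
  then have len: "length xs' = length xs" "length ys' = length ys"
    by (metis size_mset)+
  have "matching_cost p (pad (length ys) xs) (pad (length xs) ys) ` {\<sigma>. \<sigma> permutes {..<length xs + length ys}}
      = matching_cost p (pad (length ys) xs') (pad (length xs) ys') ` {\<sigma>. \<sigma> permutes {..<length xs + length ys}}"
    by (intro equalityI matching_cost_perm_image) (simp_all add: pad_def eq len)
  then show ?thesis
    by (simp add: wasserstein_def wasserstein_list_def flip: xs'_def ys'_def add: len)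
qed

section \<open>Persistence landscapes\<close>

text \<open>Positions are counted from 1 and elements are listed in decreasing order.\<close>

definition kmax :: "nat \<Rightarrow> real multiset \<Rightarrow> real" where
  "kmax k A = (if 1 \<le> k \<and> k \<le> size A then rev (sorted_list_of_multiset A) ! (k - 1) else 0)"

definition landscape :: "(real \<times> real) multiset \<Rightarrow> nat \<times> real \<Rightarrow> real" where
  "landscape \<alpha> = (\<lambda>(k, t). kmax k (image_mset (\<lambda>x. triangle (Some x) t) \<alpha>))"

definition landscape_measure :: "(nat \<times> real) measure" where
  "landscape_measure = count_space {1..} \<Otimes>\<^sub>M lborel"

end

theory Submission
  imports Defs
begin

text \<open>
  The proof compares landscapes one time \<open>t\<close> at a time. A matching of the padded diagrams pairs the
  heights \<open>triangle x t\<close> of the points of one diagram with those of the other, and the values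
  \<open>landscape \<alpha> (k, t)\<close> are these heights in decreasing order. Among all ways of matching
  two finite families of reals, the one that respects the order has the least total cost, for every
  convex cost function of the difference (\<open>sum_kmax_diff_le\<close>): a crossing can be undone without
  raising the cost (\<open>convex_exchange\<close>). The cost \<open>\<bar>u\<bar> powr p\<close>, integrated over \<open>t\<close>, gives
  stability for finite \<open>p\<close>, since the sum over the matched pairs and the integral can be
  interchanged. The cost \<open>max 0 (\<bar>u\<bar> - c)\<close>, which is zero exactly when
  \<open>\<bar>u\<bar> \<le> c\<close>, gives the corresponding bound on largest differences (\<open>kmax_diff_le\<close>), and with it
  stability for \<open>p = \<infinity>\<close> as well as the continuity and measurability of landscapes.

  Integrability is stability against the empty diagram, whose landscape is zero: matching every point
  with the basepoint has finite cost because triangles are bounded with bounded support.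

  For injectivity, landscapes that agree almost everywhere agree everywhere, because they are
  continuous in \<open>t\<close>. The number of \<open>k\<close> for which \<open>landscape \<alpha> (k, t)\<close> is at least \<open>r > 0\<close> is the
  number of intervals of \<open>\<alpha>\<close> that contain \<open>[t - r, t + r]\<close> (\<open>card_landscape_ge\<close>), so the landscape
  determines how many intervals of \<open>\<alpha>\<close> contain any given interval of positive length. These counts
  determine the diagram (\<open>diagram_eq_if_rank_eq\<close>): look at a longest interval whose multiplicities
  differ.
\<close>

section \<open>Triangle functions\<close>

text \<open>
  The nearest point of the complement is \<open>t\<close> itself or the nearer end point. For \<open>d \<le> b\<close> the
  open interval is empty, and both sides vanish.
\<close>

lemma triangle_Some_eq: "triangle (Some (b, d)) t = max 0 (min (t - b) (d - t))"
proof -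
  have "(INF a \<in> - {b<..<d}. \<bar>t - a\<bar>) = max 0 (min (t - b) (d - t))"
  proof (rule cInf_eq_minimum)
    define a where "a = (if t \<le> b \<or> d \<le> t then t else if t - b \<le> d - t then b else d)"
    have "max 0 (min (t - b) (d - t)) = \<bar>t - a\<bar>" "a \<in> - {b<..<d}"
      by (auto simp: a_def)
    then show "max 0 (min (t - b) (d - t)) \<in> (\<lambda>a. \<bar>t - a\<bar>) ` (- {b<..<d})"
      by blast
  qed auto
  then show ?thesis by simp
qed

declare triangle.simps(2) [simp del]

lemma triangle_nonneg: "0 \<le> triangle x t"
  by (cases x) (auto simp: triangle_Some_eq)

lemma triangle_lipschitz: "\<bar>triangle x t - triangle x s\<bar> \<le> \<bar>t - s\<bar>"
  by (cases x) (auto simp: triangle_Some_eq)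

text \<open>
  The tent over \<open>(b, d)\<close> reaches height \<open>r\<close> at \<open>t\<close> exactly when \<open>[b, d]\<close> contains
  \<open>[t - r, t + r]\<close>. This turns heights of landscapes into counts of containing intervals.
\<close>

lemma triangle_ge_iff: "0 < r \<Longrightarrow> r \<le> triangle (Some (b, d)) t \<longleftrightarrow> b \<le> t - r \<and> t + r \<le> d"
  by (auto simp: triangle_Some_eq)

lemma triangle_le_indicator:
  "triangle (Some (b, d)) t \<le> \<bar>d - b\<bar> * indicator {b..d} t"
  by (auto simp: triangle_Some_eq indicator_def)

lemma continuous_on_triangle: "continuous_on UNIV (triangle x)"
proof -
  have "1-lipschitz_on UNIV (triangle x)"
    using triangle_lipschitz by (intro lipschitz_onI) (auto simp: dist_real_def)
  then show ?thesis by (rule lipschitz_on_continuous_on)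
qed

lemma borel_measurable_triangle [measurable]: "triangle x \<in> borel_measurable borel"
  by (intro borel_measurable_continuous_onI continuous_on_triangle)

section \<open>Order statistics\<close>

text \<open>
  Removing a maximal element shifts the order statistics by one. Inductions on the size of a
  multiset can use these two equations and avoid the sorted list behind \<open>kmax\<close>.
\<close>

lemma kmax_add_mset_max:
  assumes "\<forall>a\<in>#A. a \<le> x"
  shows "kmax (Suc 0) (add_mset x A) = x"
    and "1 \<le> k \<Longrightarrow> kmax (Suc k) (add_mset x A) = kmax k A"
proof -
  have "sorted_list_of_multiset (add_mset x A) = sort (sorted_list_of_multiset A @ [x])"
    by (metis sorted_list_of_multiset_mset mset_append mset_sorted_list_of_multiset
        mset_single_iff_right union_mset_add_mset_right add.right_neutral)
  also have "\<dots> = sorted_list_of_multiset A @ [x]"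
    using assms by (intro sort_key_id_if_sorted) (auto simp: sorted_append)
  finally have eq: "sorted_list_of_multiset (add_mset x A) = sorted_list_of_multiset A @ [x]" .
  show "kmax (Suc 0) (add_mset x A) = x"
    by (simp add: kmax_def eq del: sorted_list_of_multiset_insert)
  show "kmax (Suc k) (add_mset x A) = kmax k A" if "1 \<le> k"
    using that by (cases k) (simp_all add: kmax_def eq del: sorted_list_of_multiset_insert)
qed

lemma length_sorted_list_of_multiset [simp]: "length (sorted_list_of_multiset A) = size A"
  by (metis mset_sorted_list_of_multiset size_mset)

text \<open>
  Padding by the basepoint adds zeros to the heights. Zeros sort below nonnegative numbers, and
  \<open>kmax\<close> is \<open>0\<close> beyond the size of its argument anyway.
\<close>

lemma kmax_add_zeros:
  assumes "\<And>a. a \<in># A \<Longrightarrow> 0 \<le> a"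
  shows "kmax k (A + replicate_mset n 0) = kmax k A"
proof -
  have "sorted_list_of_multiset (A + replicate_mset n 0) =
      sort (replicate n 0 @ sorted_list_of_multiset A)"
    by (metis add.commute mset_append mset_replicate mset_sorted_list_of_multiset
        sorted_list_of_multiset_mset)
  also have "\<dots> = replicate n 0 @ sorted_list_of_multiset A"
    using assms by (intro sort_key_id_if_sorted) (auto simp: sorted_append)
  finally show ?thesis
    by (auto simp: kmax_def nth_append)
qed

text \<open>
  Positivity of \<open>r\<close> matters: infinitely many \<open>k\<close> satisfy \<open>0 \<le> kmax (Suc k) A\<close>.
\<close>

lemma card_kmax_ge:
  assumes "0 < r"
  shows "card {k. r \<le> kmax (Suc k) A} = size (filter_mset (\<lambda>a. r \<le> a) A)"
proof -
  define l where "l = rev (sorted_list_of_multiset A)"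
  have l: "mset l = A" "length l = size A" by (simp_all add: l_def)
  have "{k. r \<le> kmax (Suc k) A} = {i. i < length l \<and> r \<le> l ! i}"
    using assms by (auto simp: kmax_def l_def split: if_splits)
  then have "card {k. r \<le> kmax (Suc k) A} = length (filter (\<lambda>a. r \<le> a) l)"
    by (simp add: length_filter_conv_card)
  also have "\<dots> = size (filter_mset (\<lambda>a. r \<le> a) A)"
    by (metis l(1) mset_filter size_mset)
  finally show ?thesis .
qed

section \<open>Sorting minimises convex costs\<close>

text \<open>
  Both sides have the same sum of arguments, and the arguments on the left lie between those on
  the right; a convex function prefers the less spread-out pair. In terms of matchings, undoing a
  crossing does not raise the cost.
\<close>

lemma convex_exchange:
  fixes \<phi> :: "real \<Rightarrow> real"
  assumes \<phi>: "convex_on UNIV \<phi>" and "x' \<le> x" "y' \<le> y"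
  shows "\<phi> (x - y) + \<phi> (x' - y') \<le> \<phi> (x - y') + \<phi> (x' - y)"
proof (cases "x = x' \<and> y = y'")
  case False
  define w where "w = (x - y') - (x' - y)"
  have w: "w > 0" using False assms by (auto simp: w_def)
  \<comment> \<open>the weight that expresses \<open>x - y\<close> as a convex combination of \<open>x - y'\<close> and \<open>x' - y\<close>\<close>
  define l where "l = (y - y') / w"
  have l: "0 \<le> l" "l \<le> 1" using w assms by (auto simp: l_def w_def field_simps)
  have lw: "l * w = y - y'" using w by (simp add: l_def)
  have eq: "x - y = (1 - l) * (x - y') + l * (x' - y)" "x' - y' = l * (x - y') + (1 - l) * (x' - y)"
    using lw by (simp_all add: w_def algebra_simps)
  have "\<phi> (x - y) \<le> (1 - l) * \<phi> (x - y') + l * \<phi> (x' - y)"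
    using convex_onD[OF \<phi> l, of "x - y'" "x' - y"] by (simp add: eq(1))
  moreover have "\<phi> (x' - y') \<le> l * \<phi> (x - y') + (1 - l) * \<phi> (x' - y)"
    using convex_onD[OF \<phi> l, of "x' - y" "x - y'"] by (simp add: eq(2) add.commute)
  ultimately show ?thesis by (simp add: algebra_simps)
qed auto

text \<open>
  The elements of \<open>M\<close> are the matched pairs of two multisets of equal size. By
  \<open>convex_exchange\<close> the two maxima may be assumed to be matched to each other; they contribute the
  same term to both sides, and removing them leaves a smaller instance.
\<close>

lemma sum_kmax_diff_le:
  fixes \<phi> :: "real \<Rightarrow> real"
  assumes \<phi>: "convex_on UNIV \<phi>"
  shows "(\<Sum>k<size M. \<phi> (kmax (Suc k) (image_mset fst M) - kmax (Suc k) (image_mset snd M)))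
           \<le> (\<Sum>(x, y)\<in>#M. \<phi> (x - y))"
proof (induction "size M" arbitrary: M)
  case 0
  then show ?case by simp
next
  case (Suc n)
  define x where "x = Max (fst ` set_mset M)"
  define y where "y = Max (snd ` set_mset M)"
  have ne: "set_mset M \<noteq> {}" using Suc(2) by auto
  have xM: "x \<in> fst ` set_mset M" and yM: "y \<in> snd ` set_mset M"
    unfolding x_def y_def using ne by (auto intro!: Max_in simp del: Max_in)
  have le: "fst z \<le> x" "snd z \<le> y" if "z \<in># M" for z
    using that by (auto simp: x_def y_def)
  \<comment> \<open>\<open>N\<close> is what remains after uncrossing, if necessary, and removing the pair of maxima.\<close>
  obtain N where N: "image_mset fst M = add_mset x (image_mset fst N)"
      "image_mset snd M = add_mset y (image_mset snd N)"
      "\<phi> (x - y) + (\<Sum>(x, y)\<in>#N. \<phi> (x - y)) \<le> (\<Sum>(x, y)\<in>#M. \<phi> (x - y))"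
  proof (cases "(x, y) \<in># M")
    case True
    then obtain N where "M = add_mset (x, y) N" by (meson multi_member_split)
    with that[of N] show ?thesis by simp
  next
    case False
    obtain y' where y': "(x, y') \<in># M" using xM by force
    obtain x' where x': "(x', y) \<in># M" using yM by force
    obtain K where K: "M = add_mset (x, y') K" using y' by (meson multi_member_split)
    have "(x', y) \<in># K" using x' y' K False by auto
    then obtain K' where K': "K = add_mset (x', y) K'" by (meson multi_member_split)
    have "x' \<le> x" "y' \<le> y" using le[OF x'] le[OF y'] by auto
    from convex_exchange[OF \<phi> this] that[of "add_mset (x', y') K'"] show ?thesis
      by (simp add: K K')
  qed
  have n: "size N = n" using Suc(2) arg_cong[OF N(1), of size] by simp
  have top: "\<forall>a\<in>#image_mset fst N. a \<le> x"
    using le(1) N(1) by (metis image_iff in_image_mset insert_iff set_mset_add_mset_insert)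
  have top': "\<forall>a\<in>#image_mset snd N. a \<le> y"
    using le(2) N(2) by (metis image_iff in_image_mset insert_iff set_mset_add_mset_insert)
  have "(\<Sum>k<size M. \<phi> (kmax (Suc k) (image_mset fst M) - kmax (Suc k) (image_mset snd M))) =
      \<phi> (x - y) + (\<Sum>k<n. \<phi> (kmax (Suc k) (image_mset fst N) - kmax (Suc k) (image_mset snd N)))"
    unfolding Suc(2)[symmetric] N(1,2) sum.lessThan_Suc_shift
    by (simp add: kmax_add_mset_max[OF top] kmax_add_mset_max[OF top'])
  also have "\<dots> \<le> \<phi> (x - y) + (\<Sum>(x, y)\<in>#N. \<phi> (x - y))"
    using Suc(1)[of N] n by simp
  also note N(3)
  finally show ?case .
qed

text \<open>
  This function vanishes exactly on \<open>\<bar>u\<bar> \<le> c\<close>. With it the rearrangement inequality for sums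
  yields a bound on maxima, which serves the exponent \<open>\<infinity>\<close>.
\<close>

lemma convex_on_abs_excess:
  "convex_on UNIV (\<lambda>u::real. max 0 (\<bar>u\<bar> - c))"
proof (rule convex_onI)
  fix t x y :: real assume t: "0 < t" "t < 1"
  have "\<bar>(1 - t) * x + t * y\<bar> \<le> (1 - t) * \<bar>x\<bar> + t * \<bar>y\<bar>"
    using t by (metis abs_mult abs_of_nonneg abs_triangle_ineq diff_ge_0_iff_ge less_imp_le)
  then have "\<bar>(1 - t) * x + t * y\<bar> - c \<le> (1 - t) * (\<bar>x\<bar> - c) + t * (\<bar>y\<bar> - c)"
    by (simp add: algebra_simps)
  also have "\<dots> \<le> (1 - t) * max 0 (\<bar>x\<bar> - c) + t * max 0 (\<bar>y\<bar> - c)"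
    using t by (intro add_mono mult_left_mono) auto
  finally show "max 0 (\<bar>(1 - t) *\<^sub>R x + t *\<^sub>R y\<bar> - c)
      \<le> (1 - t) * max 0 (\<bar>x\<bar> - c) + t * max 0 (\<bar>y\<bar> - c)"
    using t by simp
qed simp

lemma kmax_diff_le:
  assumes M: "\<And>x y. (x, y) \<in># M \<Longrightarrow> \<bar>x - y\<bar> \<le> c" and "0 \<le> c"
  shows "\<bar>kmax k (image_mset fst M) - kmax k (image_mset snd M)\<bar> \<le> c"
proof (cases "1 \<le> k \<and> k \<le> size M")
  case True
  then obtain j where j: "k = Suc j" "j < size M" by (cases k) auto
  define \<phi> where "\<phi> = (\<lambda>u::real. max 0 (\<bar>u\<bar> - c))"
  define D where "D k = kmax (Suc k) (image_mset fst M) - kmax (Suc k) (image_mset snd M)" for k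
  have "(\<Sum>k<size M. \<phi> (D k)) \<le> (\<Sum>(x, y)\<in>#M. \<phi> (x - y))"
    unfolding D_def \<phi>_def by (intro sum_kmax_diff_le convex_on_abs_excess)
  also have "(\<Sum>(x, y)\<in>#M. \<phi> (x - y)) = (\<Sum>z\<in>#M. 0)"
    using M by (intro arg_cong[where f = sum_mset] image_mset_cong) (auto simp: \<phi>_def)
  finally have "(\<Sum>k<size M. \<phi> (D k)) \<le> 0" by simp
  moreover have "\<phi> (D j) \<le> (\<Sum>k<size M. \<phi> (D k))"
    using j by (intro member_le_sum) (auto simp: \<phi>_def)
  ultimately show ?thesis by (simp add: \<phi>_def D_def j)
qed (use assms(2) in \<open>auto simp: kmax_def\<close>)

text \<open>
  On positive reals this is \<open>powr_convex\<close>. At a zero of one of the arguments the convexity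
  inequality reduces to \<open>s powr r \<le> s\<close> for \<open>0 < s < 1\<close>.
\<close>

lemma convex_on_abs_powr:
  assumes "1 \<le> r"
  shows "convex_on UNIV (\<lambda>u::real. \<bar>u\<bar> powr r)"
proof (rule convex_onI)
  fix t x y :: real assume t: "0 < t" "t < 1"
  have shrink: "(s * v) powr r \<le> s * v powr r" if "0 < s" "s < 1" "0 \<le> v" for s v :: real
  proof -
    have "s powr r \<le> s powr 1" using that assms by (intro powr_mono') auto
    then show ?thesis using that by (simp add: powr_mult mult_right_mono)
  qed
  have pos: "((1 - t) * u + t * v) powr r \<le> (1 - t) * u powr r + t * v powr r"
    if "0 \<le> u" "0 \<le> v" for u v
  proof -
    consider "u = 0" | "v = 0" | "0 < u" "0 < v" using \<open>0 \<le> u\<close> \<open>0 \<le> v\<close> by linarith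
    then show ?thesis
    proof cases
      case 1
      then show ?thesis using shrink[of t v] t that assms by simp
    next
      case 2
      then show ?thesis using shrink[of "1 - t" u] t that assms by simp
    next
      case 3
      then show ?thesis using convex_onD[OF powr_convex[OF assms], of t u v] t by simp
    qed
  qed
  have "\<bar>(1 - t) * x + t * y\<bar> \<le> (1 - t) * \<bar>x\<bar> + t * \<bar>y\<bar>"
    using t by (metis abs_mult abs_of_nonneg abs_triangle_ineq diff_ge_0_iff_ge less_imp_le)
  then have "\<bar>(1 - t) * x + t * y\<bar> powr r \<le> ((1 - t) * \<bar>x\<bar> + t * \<bar>y\<bar>) powr r"
    using assms by (intro powr_mono2) auto
  also have "\<dots> \<le> (1 - t) * \<bar>x\<bar> powr r + t * \<bar>y\<bar> powr r"
    by (rule pos) auto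
  finally show "\<bar>(1 - t) *\<^sub>R x + t *\<^sub>R y\<bar> powr r \<le> (1 - t) * \<bar>x\<bar> powr r + t * \<bar>y\<bar> powr r"
    by simp
qed simp

section \<open>Regularity of landscapes\<close>

text \<open>
  Matching each point with itself at the two times \<open>t\<close> and \<open>s\<close>, the Lipschitz bound for
  triangles passes to the order statistics.
\<close>

lemma kmax_triangle_lipschitz:
  "\<bar>kmax k (image_mset (\<lambda>x. triangle x t) A) - kmax k (image_mset (\<lambda>x. triangle x s) A)\<bar> \<le> \<bar>t - s\<bar>"
  using kmax_diff_le[of "image_mset (\<lambda>x. (triangle x t, triangle x s)) A" "\<bar>t - s\<bar>" k] triangle_lipschitz
  by (auto simp: multiset.map_comp comp_def)

lemma continuous_on_landscape: "continuous_on UNIV (\<lambda>t. landscape \<alpha> (k, t))"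
proof -
  have "1-lipschitz_on UNIV (\<lambda>t. landscape \<alpha> (k, t))"
    using kmax_triangle_lipschitz[of k _ "image_mset Some \<alpha>"]
    by (intro lipschitz_onI) (auto simp: landscape_def dist_real_def multiset.map_comp comp_def)
  then show ?thesis by (rule lipschitz_on_continuous_on)
qed

lemma borel_measurable_landscape [measurable]:
  "landscape \<alpha> \<in> borel_measurable landscape_measure"
  unfolding landscape_measure_def
  by (intro measurable_pair_measure_countable1 countableI_type)
    (simp add: borel_measurable_continuous_onI continuous_on_landscape)

interpretation landscape_measure: pair_sigma_finite "count_space {1::nat..}" "lborel :: real measure"
  by (simp add: pair_sigma_finite_def sigma_finite_measure_count_space_countable lborel.sigma_finite_measure_axioms)

section \<open>Injectivity\<close>

text \<open>
  The coincidence set is closed, and a closed set of full Lebesgue measure is everything.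
\<close>

lemma AE_lborel_continuous_eq:
  fixes f g :: "real \<Rightarrow> real"
  assumes "continuous_on UNIV f" "continuous_on UNIV g" and "AE t in lborel. f t = g t"
  shows "f t = g t"
proof -
  have "closed {t. f t = g t}"
    using assms by (intro closed_Collect_eq)
  moreover have "AE t in lebesgue. t \<in> {t. f t = g t}"
    using AE_completion[OF assms(3)] by simp
  ultimately show ?thesis
    using mem_closed_if_AE_lebesgue by blast
qed

lemma AE_landscape_eqD:
  assumes "AE z in landscape_measure. landscape \<alpha> z = landscape \<beta> z"
  shows "landscape \<alpha> (Suc k, t) = landscape \<beta> (Suc k, t)"
proof -
  have "AE k in count_space {1..}. AE t in lborel. landscape \<alpha> (k, t) = landscape \<beta> (k, t)"
    using landscape_measure.AE_pair[OF assms[unfolded landscape_measure_def]] by simp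
  then have "AE t in lborel. landscape \<alpha> (Suc k, t) = landscape \<beta> (Suc k, t)"
    by (simp add: AE_count_space)
  then show ?thesis
    by (intro AE_lborel_continuous_eq[of "\<lambda>t. landscape \<alpha> (Suc k, t)"] continuous_on_landscape)
qed

text \<open>
  The landscape determines the rank function of the diagram, which counts the intervals
  containing a given \<open>[u, v]\<close>: take \<open>t\<close> to be the midpoint and \<open>r\<close> half the length.
\<close>

lemma card_landscape_ge:
  assumes "0 < r"
  shows "card {k. r \<le> landscape \<alpha> (Suc k, t)} =
         size (filter_mset (\<lambda>x. fst x \<le> t - r \<and> t + r \<le> snd x) \<alpha>)"
proof -
  have "card {k. r \<le> landscape \<alpha> (Suc k, t)} =
      size (filter_mset (\<lambda>x. r \<le> triangle (Some x) t) \<alpha>)"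
    using card_kmax_ge[OF assms] by (simp add: landscape_def filter_mset_image_mset comp_def)
  also have "filter_mset (\<lambda>x. r \<le> triangle (Some x) t) \<alpha>
      = filter_mset (\<lambda>x. fst x \<le> t - r \<and> t + r \<le> snd x) \<alpha>"
    using triangle_ge_iff[OF assms] by (intro filter_mset_cong) auto
  finally show ?thesis .
qed

text \<open>
  Suppose the multiplicities differ somewhere, and let \<open>x\<close> be a longest interval where they do.
  Every other interval containing \<open>x\<close> is strictly longer, hence has equal multiplicities in the
  two diagrams, so the ranks at \<open>x\<close> differ by the difference of the multiplicities of \<open>x\<close>.
\<close>

lemma diagram_eq_if_rank_eq:
  fixes \<alpha> \<beta> :: "(real \<times> real) multiset"
  assumes diag: "\<alpha> \<in> diagrams" "\<beta> \<in> diagrams"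
    and rank: "\<And>u v. u < v \<Longrightarrow> size (filter_mset (\<lambda>x. fst x \<le> u \<and> v \<le> snd x) \<alpha>)
                           = size (filter_mset (\<lambda>x. fst x \<le> u \<and> v \<le> snd x) \<beta>)"
  shows "\<alpha> = \<beta>"
proof (rule ccontr)
  assume neq: "\<alpha> \<noteq> \<beta>"
  define S where "S = {x. count \<alpha> x \<noteq> count \<beta> x}"
  have fin: "finite S"
    by (rule finite_subset[of _ "set_mset \<alpha> \<union> set_mset \<beta>"]) (auto simp: S_def count_eq_zero_iff[symmetric])
  have "S \<noteq> {}" using neq by (auto simp: S_def multiset_eq_iff)
  define len where "len = (\<lambda>x::real \<times> real. snd x - fst x)"
  have "Max (len ` S) \<in> len ` S"
    using fin \<open>S \<noteq> {}\<close> by (intro Max_in) auto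
  then obtain x where xS: "x \<in> S" and "len x = Max (len ` S)"
    by force
  then have longest: "snd y - fst y \<le> snd x - fst x" if "y \<in> S" for y
    using Max_ge[of "len ` S" "len y"] fin that by (simp add: len_def)
  have "x \<in># \<alpha> \<or> x \<in># \<beta>" using xS by (force simp: S_def count_eq_zero_iff[symmetric])
  then have "fst x < snd x" using diag by (auto simp: diagrams_def)
  define P where "P = (\<lambda>y. fst y \<le> fst x \<and> snd x \<le> snd y)"
  have eq: "count \<alpha> y = count \<beta> y" if "P y" "y \<noteq> x" for y
  proof (rule ccontr)
    assume "count \<alpha> y \<noteq> count \<beta> y"
    then have "snd y - fst y \<le> snd x - fst x" by (intro longest) (simp add: S_def)
    with that show False by (auto simp: P_def prod_eq_iff)
  qed
  have split: "size (filter_mset P \<gamma>) = count \<gamma> x + size (filter_mset (\<lambda>y. P y \<and> y \<noteq> x) \<gamma>)" for \<gamma>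
  proof -
    have "filter_mset P \<gamma> = replicate_mset (count \<gamma> x) x + filter_mset (\<lambda>y. P y \<and> y \<noteq> x) \<gamma>"
      by (auto simp: multiset_eq_iff P_def)
    then show ?thesis by simp
  qed
  have "filter_mset (\<lambda>y. P y \<and> y \<noteq> x) \<alpha> = filter_mset (\<lambda>y. P y \<and> y \<noteq> x) \<beta>"
    using eq by (auto simp: multiset_eq_iff)
  then have "count \<alpha> x = count \<beta> x"
    using split[of \<alpha>] split[of \<beta>] rank[OF \<open>fst x < snd x\<close>] by (simp add: P_def)
  with xS show False by (simp add: S_def)
qed

lemma inj_on_landscape_class:
  "inj_on (\<lambda>\<alpha>. ae_class landscape_measure (landscape \<alpha>)) diagrams"
proof (rule inj_onI)
  fix \<alpha> \<beta> assume diag: "\<alpha> \<in> diagrams" "\<beta> \<in> diagrams"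
    and eq: "ae_class landscape_measure (landscape \<alpha>) = ae_class landscape_measure (landscape \<beta>)"
  have "landscape \<alpha> \<in> ae_class landscape_measure (landscape \<beta>)"
    unfolding eq[symmetric] by (simp add: ae_class_def)
  then have ae: "AE z in landscape_measure. landscape \<alpha> z = landscape \<beta> z"
    by (simp add: ae_class_def)
  show "\<alpha> = \<beta>"
  proof (rule diagram_eq_if_rank_eq[OF diag])
    fix u v :: real assume "u < v"
    define t r where "t = (u + v) / 2" and "r = (v - u) / 2"
    have r: "0 < r" "t - r = u" "t + r = v" using \<open>u < v\<close> by (simp_all add: t_def r_def field_simps)
    show "size (filter_mset (\<lambda>x. fst x \<le> u \<and> v \<le> snd x) \<alpha>)
        = size (filter_mset (\<lambda>x. fst x \<le> u \<and> v \<le> snd x) \<beta>)"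
      using card_landscape_ge[OF r(1), of \<alpha> t] card_landscape_ge[OF r(1), of \<beta> t]
        AE_landscape_eqD[OF ae] by (simp add: r(2,3))
  qed
qed

section \<open>Landscapes and matched diagrams\<close>

definition matched_heights ::
    "(real \<times> real) option list \<Rightarrow> (real \<times> real) option list \<Rightarrow> (nat \<Rightarrow> nat) \<Rightarrow> real
      \<Rightarrow> (real \<times> real) multiset" where
  "matched_heights as bs \<sigma> t =
     image_mset (\<lambda>i. (triangle (as ! i) t, triangle (bs ! \<sigma> i) t)) (mset_set {..<length as})"

lemma landscape_eq_kmax_pad:
  "landscape (mset xs) (k, t) = kmax k (image_mset (\<lambda>x. triangle x t) (mset (pad n xs)))"
proof -
  have "image_mset (\<lambda>x. triangle x t) (mset (pad n xs)) =
      image_mset (\<lambda>x. triangle (Some x) t) (mset xs) + replicate_mset n 0"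
    by (simp add: pad_def multiset.map_comp comp_def)
  moreover have "kmax k (image_mset (\<lambda>x. triangle (Some x) t) (mset xs) + replicate_mset n 0)
      = kmax k (image_mset (\<lambda>x. triangle (Some x) t) (mset xs))"
    using triangle_nonneg by (intro kmax_add_zeros) (auto)
  ultimately show ?thesis
    by (simp add: landscape_def)
qed

lemma image_mset_nth_permutes:
  assumes "\<sigma> permutes {..<length bs}"
  shows "image_mset (\<lambda>i. f (bs ! \<sigma> i)) (mset_set {..<length bs}) = image_mset f (mset bs)"
proof -
  have "image_mset (\<lambda>i. f (bs ! \<sigma> i)) (mset_set {..<length bs})
      = image_mset (\<lambda>i. f (bs ! i)) (image_mset \<sigma> (mset_set {..<length bs}))"
    by (simp add: multiset.map_comp comp_def)
  also have "image_mset \<sigma> (mset_set {..<length bs}) = mset_set {..<length bs}"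
    using assms by (simp add: image_mset_mset_set permutes_inj_on permutes_image)
  also have "image_mset (\<lambda>i. f (bs ! i)) (mset_set {..<length bs}) = mset (map (\<lambda>i. f (bs ! i)) [0..<length bs])"
    by (simp add: lessThan_atLeast0)
  also have "map (\<lambda>i. f (bs ! i)) [0..<length bs] = map f bs"
    by (rule nth_equalityI) auto
  finally show ?thesis by simp
qed

text \<open>
  For a fixed \<open>t\<close>, a matching of the padded diagrams pairs up the heights of their triangles. Its
  two marginals recover both landscapes, which brings them into the form required by
  \<open>sum_kmax_diff_le\<close> and \<open>kmax_diff_le\<close>.
\<close>

lemma landscape_eq_kmax_matched:
  assumes "\<sigma> permutes {..<length xs + length ys}"
  defines "M \<equiv> matched_heights (pad (length ys) xs) (pad (length xs) ys) \<sigma>"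
  shows "landscape (mset xs) (k, t) = kmax k (image_mset fst (M t))"
    and "landscape (mset ys) (k, t) = kmax k (image_mset snd (M t))"
proof -
  let ?as = "pad (length ys) xs" and ?bs = "pad (length xs) ys"
  have len: "length ?as = length xs + length ys" "length ?bs = length xs + length ys"
    by (simp_all add: pad_def)
  have "image_mset fst (M t) = image_mset (\<lambda>x. triangle x t) (mset ?as)"
    using image_mset_nth_permutes[OF permutes_id, of "\<lambda>x. triangle x t" ?as]
    by (simp add: M_def matched_heights_def multiset.map_comp comp_def id_def)
  then show "landscape (mset xs) (k, t) = kmax k (image_mset fst (M t))"
    by (simp add: landscape_eq_kmax_pad)
  have "image_mset snd (M t) = image_mset (\<lambda>x. triangle x t) (mset ?bs)"
    using image_mset_nth_permutes[of \<sigma> ?bs "\<lambda>x. triangle x t"] assms(1)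
    by (simp add: M_def matched_heights_def multiset.map_comp comp_def len)
  then show "landscape (mset ys) (k, t) = kmax k (image_mset snd (M t))"
    by (simp add: landscape_eq_kmax_pad)
qed

lemma landscape_out_of_range: "size \<alpha> < k \<Longrightarrow> landscape \<alpha> (k, t) = 0"
  by (simp add: landscape_def kmax_def)

lemma sum_mset_matched_heights:
  "(\<Sum>(x, y)\<in>#matched_heights as bs \<sigma> t. \<phi> (x - y))
     = (\<Sum>i<length as. \<phi> (triangle (as ! i) t - triangle (bs ! \<sigma> i) t))"
  by (simp add: matched_heights_def multiset.map_comp comp_def sum_unfold_sum_mset)

section \<open>Norms\<close>

lemma epowr_ennreal: "0 \<le> u \<Longrightarrow> epowr (ennreal u) r = ennreal (u powr r)"
  by (simp add: epowr_def)

lemma epowr_mono: "x \<le> y \<Longrightarrow> 0 \<le> r \<Longrightarrow> epowr x r \<le> epowr y r"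
  by (auto simp: epowr_def top.not_eq_extremum top_unique intro!: ennreal_leI powr_mono2 enn2real_mono)

lemma epowr_less_top: "x < \<infinity> \<Longrightarrow> epowr x r < \<infinity>"
  by (simp add: epowr_def)

lemma epowr_epowr_inverse: "0 < r \<Longrightarrow> epowr (epowr x (1 / r)) r = x"
  by (auto simp: epowr_def powr_powr ennreal_enn2real_if)

lemma enn2real_ge_1: "1 \<le> p \<Longrightarrow> p \<noteq> \<infinity> \<Longrightarrow> 1 \<le> enn2real p"
  using enn2real_mono[of 1 p] by (simp add: top.not_eq_extremum)

lemma Lp_norm_finite_powr:
  assumes "1 \<le> p" "p \<noteq> \<infinity>"
  shows "epowr (Lp_norm p M f) (enn2real p) = (\<integral>\<^sup>+z. ennreal (\<bar>f z\<bar> powr enn2real p) \<partial>M)"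
  using assms enn2real_ge_1[OF assms]
  by (simp add: Lp_norm_def Lp_enorm_def epowr_epowr_inverse epowr_ennreal)

lemma Lp_enorm_count_space_less_top:
  assumes "finite A" and g: "\<And>i. i \<in> A \<Longrightarrow> g i < \<infinity>"
  shows "Lp_enorm p (count_space A) g < \<infinity>"
proof (cases "p = \<infinity>")
  case True
  have "esssup (count_space A) g \<le> (\<Sum>i\<in>A. g i)"
    using assms(1) by (intro esssup_I) (auto simp: AE_count_space intro: member_le_sum)
  also have "\<dots> < \<infinity>" using g by (simp add: assms(1))
  finally show ?thesis using True by (simp add: Lp_enorm_def)
next
  case False
  have "(\<integral>\<^sup>+i. epowr (g i) (enn2real p) \<partial>count_space A) < \<infinity>"
    using assms epowr_less_top[OF g] by (simp add: nn_integral_count_space_finite)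
  then show ?thesis using False epowr_less_top by (simp add: Lp_enorm_def)
qed

lemma triangle_dist_basepoint_less_top:
  assumes "1 \<le> p"
  shows "triangle_dist p (Some x) None < \<infinity>"
proof -
  obtain b d where x: "x = (b, d)" by (cases x)
  define f where "f = triangle (Some (b, d))"
  define D where "D = \<bar>d - b\<bar>"
  have f: "0 \<le> f t" "f t \<le> D * indicator {b..d} t" for t
    unfolding f_def D_def by (rule triangle_nonneg triangle_le_indicator)+
  have fD: "f t \<le> D" for t
    using f(2)[of t] by (cases "t \<in> {b..d}") (simp_all add: D_def)
  have [measurable]: "f \<in> borel_measurable borel" by (simp add: f_def borel_measurable_triangle)
  have "Lp_norm p lborel f < \<infinity>"
  proof (cases "p = \<infinity>")
    case True
    have "esssup lborel (\<lambda>t. ennreal \<bar>f t\<bar>) \<le> ennreal D"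
      using f(1) fD by (intro esssup_I) (auto intro!: ennreal_leI)
    then show ?thesis using True by (simp add: Lp_norm_def Lp_enorm_def le_less_trans)
  next
    case False
    define r where "r = enn2real p"
    have r: "1 \<le> r" using enn2real_ge_1 assms False by (simp add: r_def)
    have "(\<integral>\<^sup>+t. epowr (ennreal \<bar>f t\<bar>) r \<partial>lborel) \<le> (\<integral>\<^sup>+t. ennreal (D powr r) * indicator {b..d} t \<partial>lborel)"
    proof (rule nn_integral_mono)
      fix t
      show "epowr (ennreal \<bar>f t\<bar>) r \<le> ennreal (D powr r) * indicator {b..d} t"
        using f[of t] r by (auto simp: epowr_ennreal indicator_def intro!: ennreal_leI powr_mono2 split: if_splits)
    qed
    also have "\<dots> < \<infinity>"
      by (simp add: nn_integral_cmult_indicator ennreal_mult_less_top emeasure_lborel_Icc_eq)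
    finally show ?thesis using False epowr_less_top by (simp add: Lp_norm_def Lp_enorm_def r_def)
  qed
  then show ?thesis by (simp add: triangle_dist_def f_def x)
qed

section \<open>Stability and integrability\<close>

text \<open>
  For finite \<open>p\<close>, Tonelli's theorem turns both \<open>p\<close>-th powers into integrals over \<open>t\<close> of finite
  sums, and the integrands are compared by the rearrangement inequality. For \<open>p = \<infinity>\<close>, at almost
  every \<open>t\<close> all matched heights differ by at most the cost, and then so do the order statistics.
\<close>

lemma Lp_norm_landscape_diff_le_matching_cost:
  assumes p: "1 \<le> p" and \<sigma>: "\<sigma> permutes {..<length xs + length ys}"
  shows "Lp_norm p landscape_measure (\<lambda>z. landscape (mset xs) z - landscape (mset ys) z)
           \<le> matching_cost p (pad (length ys) xs) (pad (length xs) ys) \<sigma>"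
proof -
  define as where "as = pad (length ys) xs"
  define bs where "bs = pad (length xs) ys"
  define N where "N = length xs + length ys"
  define F where "F = (\<lambda>z. landscape (mset xs) z - landscape (mset ys) z)"
  define g where "g = (\<lambda>i t. triangle (as ! i) t - triangle (bs ! \<sigma> i) t)"
  define M where "M = matched_heights as bs \<sigma>"
  have len: "length as = N" by (simp add: as_def pad_def N_def)
  have [measurable]: "F \<in> borel_measurable landscape_measure" by (simp add: F_def)
  have [measurable]: "g i \<in> borel_measurable borel" for i by (simp add: g_def)
  have F: "F (k, t) = kmax k (image_mset fst (M t)) - kmax k (image_mset snd (M t))" for k t
    using landscape_eq_kmax_matched[OF \<sigma>, of k t] by (simp add: F_def M_def as_def bs_def)
  have F0: "F (k, t) = 0" if "N < k" for k t
    using that by (simp add: F_def N_def landscape_out_of_range)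
  have cost: "matching_cost p as bs \<sigma> = Lp_enorm p (count_space {..<N}) (\<lambda>i. Lp_norm p lborel (g i))"
    by (simp add: matching_cost_def triangle_dist_def g_def len)
  have "Lp_norm p landscape_measure F \<le> matching_cost p as bs \<sigma>"
  proof (cases "p = \<infinity>")
    case True
    define C where "C = matching_cost p as bs \<sigma>"
    show ?thesis
    proof (cases "C = \<infinity>")
      case False
      then obtain c where c: "0 \<le> c" "C = ennreal c" by (cases C) auto
      have "AE t in lborel. \<bar>g i t\<bar> \<le> c" if "i < N" for i
      proof -
        have "AE i in count_space {..<N}. Lp_norm p lborel (g i) \<le> C"
          using esssup_AE[of "\<lambda>i. Lp_norm p lborel (g i)" "count_space {..<N}"] True
          unfolding C_def cost by (simp add: Lp_enorm_def)
        then have "Lp_norm p lborel (g i) \<le> C" using that by (simp add: AE_count_space)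
        moreover have "AE t in lborel. ennreal \<bar>g i t\<bar> \<le> Lp_norm p lborel (g i)"
          using esssup_AE[of "\<lambda>t. ennreal \<bar>g i t\<bar>" lborel] True by (simp add: Lp_norm_def Lp_enorm_def)
        ultimately have "AE t in lborel. ennreal \<bar>g i t\<bar> \<le> ennreal c"
          unfolding c(2) by (auto elim!: eventually_mono intro: order_trans)
        then show ?thesis
          using c(1) by simp
      qed
      then have "AE t in lborel. \<forall>i\<in>{..<N}. \<bar>g i t\<bar> \<le> c"
        by (intro AE_finite_allI) auto
      then have "AE t in lborel. \<bar>F (k, t)\<bar> \<le> c" for k
      proof (rule eventually_mono)
        fix t assume "\<forall>i\<in>{..<N}. \<bar>g i t\<bar> \<le> c"
        then show "\<bar>F (k, t)\<bar> \<le> c"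
          unfolding F using c(1)
          by (intro kmax_diff_le) (auto simp: M_def matched_heights_def g_def len)
      qed
      moreover have meas: "{z \<in> space landscape_measure. \<bar>F z\<bar> \<le> c} \<in> sets landscape_measure"
        by measurable
      ultimately have "AE z in landscape_measure. \<bar>F z\<bar> \<le> c"
        unfolding landscape_measure_def
        by (intro landscape_measure.AE_pair_measure meas[unfolded landscape_measure_def]) simp
      then have "esssup landscape_measure (\<lambda>z. ennreal \<bar>F z\<bar>) \<le> C"
        unfolding c by (intro esssup_I) (auto elim!: eventually_mono intro!: ennreal_leI)
      then show ?thesis using True by (simp add: Lp_norm_def Lp_enorm_def C_def)
    qed (simp add: C_def)
  next
    case False
    define r where "r = enn2real p"
    have r: "1 \<le> r" using enn2real_ge_1 p False by (simp add: r_def)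
    have powr: "epowr (Lp_norm p lborel (g i)) r = (\<integral>\<^sup>+t. ennreal (\<bar>g i t\<bar> powr r) \<partial>lborel)" for i
      unfolding r_def by (rule Lp_norm_finite_powr[OF p False])
    have meas: "(\<lambda>z. ennreal (\<bar>F z\<bar> powr r)) \<in> borel_measurable landscape_measure"
      by measurable
    have "(\<integral>\<^sup>+z. ennreal (\<bar>F z\<bar> powr r) \<partial>landscape_measure)
        = (\<integral>\<^sup>+t. \<integral>\<^sup>+k. ennreal (\<bar>F (k, t)\<bar> powr r) \<partial>count_space {1..} \<partial>lborel)"
      unfolding landscape_measure_def
      by (rule landscape_measure.nn_integral_snd[symmetric, OF meas[unfolded landscape_measure_def]])
    also have "\<dots> = (\<integral>\<^sup>+t. (\<Sum>k\<in>{1..N}. ennreal (\<bar>F (k, t)\<bar> powr r)) \<partial>lborel)"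
      using F0 by (intro nn_integral_cong nn_integral_count_space') auto
    also have "\<dots> \<le> (\<integral>\<^sup>+t. (\<Sum>i<N. ennreal (\<bar>g i t\<bar> powr r)) \<partial>lborel)"
    proof (rule nn_integral_mono)
      fix t
      have "(\<Sum>k\<in>{1..N}. \<bar>F (k, t)\<bar> powr r) = (\<Sum>k<N. \<bar>F (Suc k, t)\<bar> powr r)"
        by (simp add: sum.atLeast1_atMost_eq)
      also have "\<dots> \<le> (\<Sum>(x, y)\<in>#M t. \<bar>x - y\<bar> powr r)"
        using sum_kmax_diff_le[OF convex_on_abs_powr[OF r], of "M t"]
        by (simp add: F M_def matched_heights_def len)
      also have "\<dots> = (\<Sum>i<N. \<bar>g i t\<bar> powr r)"
        unfolding M_def sum_mset_matched_heights[of "\<lambda>u. \<bar>u\<bar> powr r"] len g_def ..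
      finally show "(\<Sum>k\<in>{1..N}. ennreal (\<bar>F (k, t)\<bar> powr r)) \<le> (\<Sum>i<N. ennreal (\<bar>g i t\<bar> powr r))"
        by (simp add: sum_ennreal ennreal_leI)
    qed
    also have "\<dots> = (\<Sum>i<N. \<integral>\<^sup>+t. ennreal (\<bar>g i t\<bar> powr r) \<partial>lborel)"
      by (rule nn_integral_sum) simp
    also have "\<dots> = (\<integral>\<^sup>+i. epowr (Lp_norm p lborel (g i)) r \<partial>count_space {..<N})"
      by (simp add: powr nn_integral_count_space_finite)
    finally show ?thesis
      using r False unfolding cost
      by (simp add: Lp_norm_def[of p landscape_measure] Lp_enorm_def[of p landscape_measure]
          Lp_enorm_def[of p "count_space _"] epowr_ennreal epowr_mono flip: r_def)
  qed
  then show ?thesis by (simp add: F_def as_def bs_def)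
qed

lemma Lp_norm_landscape_diff_le_wasserstein:
  assumes "1 \<le> p"
  shows "Lp_norm p landscape_measure (\<lambda>z. landscape \<alpha> z - landscape \<beta> z) \<le> wasserstein p \<alpha> \<beta>"
proof -
  obtain xs ys where \<alpha>\<beta>: "\<alpha> = mset xs" "\<beta> = mset ys" by (metis ex_mset)
  have "{\<sigma>. \<sigma> permutes {..<length xs + length ys}} \<noteq> {}"
    using permutes_id by blast
  then show ?thesis
    unfolding \<alpha>\<beta> wasserstein_mset wasserstein_list_def
    by (subst Min_ge_iff)
      (auto simp: finite_permutations intro: Lp_norm_landscape_diff_le_matching_cost[OF assms])
qed

text \<open>
  Matching every point with the basepoint has finite cost. Since the landscape of the empty diagram
  vanishes, stability then bounds the norm of every landscape.
\<close>

lemma wasserstein_empty_less_top: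
  assumes "1 \<le> p"
  shows "wasserstein p \<alpha> {#} < \<infinity>"
proof -
  obtain xs where \<alpha>: "\<alpha> = mset xs" by (metis ex_mset)
  have "wasserstein p \<alpha> {#} = wasserstein_list p xs []"
    using wasserstein_mset[of p xs "[]"] by (simp add: \<alpha>)
  also have "\<dots> \<le> matching_cost p (map Some xs) (replicate (length xs) None) id"
    unfolding wasserstein_list_def pad_def
    by (intro Min_le) (auto simp: finite_permutations permutes_id)
  also have "\<dots> < \<infinity>"
    unfolding matching_cost_def
    by (intro Lp_enorm_count_space_less_top) (simp_all add: triangle_dist_basepoint_less_top[OF assms, simplified])
  finally show ?thesis .
qed

lemma landscape_in_Lp_functions:
  assumes "1 \<le> p"
  shows "landscape \<alpha> \<in> Lp_functions p landscape_measure"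
proof -
  have "landscape {#} z = 0" for z
    by (cases z) (simp add: landscape_def kmax_def)
  then have "Lp_norm p landscape_measure (landscape \<alpha>) \<le> wasserstein p \<alpha> {#}"
    using Lp_norm_landscape_diff_le_wasserstein[OF assms, of \<alpha> "{#}"] by simp
  then show ?thesis
    using wasserstein_empty_less_top[OF assms] by (auto simp: Lp_functions_def le_less_trans)
qed

theorem theorem3p6:
  fixes p :: ennreal
  assumes "1 \<le> p"
  shows "(\<forall>\<alpha>\<in>diagrams. landscape \<alpha> \<in> Lp_functions p landscape_measure) \<and>
         inj_on (\<lambda>\<alpha>. ae_class landscape_measure (landscape \<alpha>)) diagrams \<and>
         (\<forall>\<alpha>\<in>diagrams. \<forall>\<beta>\<in>diagrams.
            Lp_norm p landscape_measure (\<lambda>z. landscape \<alpha> z - landscape \<beta> z)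
              \<le> wasserstein p \<alpha> \<beta>)"
  using landscape_in_Lp_functions[OF assms] inj_on_landscape_class
    Lp_norm_landscape_diff_le_wasserstein[OF assms] by blast

end
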